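(* Every equicontinuous semi-group action on a metrizable space is $R$-closed and of characteristic $0$.
   Context: A semi-group action of a topological semi-group $T$ with unit element $e$ on a topological space $X$ is a continuous map $v\colon T\times X\to X$ such that each $v(t,\cdot)\colon X\to X$ is a homeomorphism, $v(e,\cdot)$ is the identity, and $v(g,v(h,x))=v(gh,x)$ for all $g,h\in T$, $x\in X$; write $g(x)=v(g,x)$. The orbit of $x$ is $T(x)=\{g(x)\mid g\in T\}$. A semi-group action on a metrizable space $X$ is equicontinuous if there is a metric $d$ compatible with the topology of $X$ such that for every $\varepsilon>0$ there is $\delta>0$ with $d(g(x),g(y))<\varepsilon$ for all $g\in T$ and all $x,y\in X$ with $d(x,y)<\delta$. The action is $R$-closed if $\{(x,y)\in X\times X\mid y\in\overline{T(x)}\}$ is closed in $X\times X$. The (bilateral) prolongation of $x$ is $D(x)=\{y\in X\mid\text{there are nets }(x_\alpha),(y_\alpha)\text{ in }X\text{ (with the same index set) such that } y_\alpha\in T(x_\alpha),\ y_\alpha\to y,\ x_\alpha\to x\}$. The action is of characteristic $0$ if $\overline{T(x)}=D(x)$ for every $x\in X$. *)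

theory Defs
  imports "HOL-Analysis.Analysis"
begin

(* The space is an abstract topology on topspace X; values of v outside topspace X are irrelevant. *)
locale semigroup_action =
  fixes X :: "'a topology"
    and v :: "'t::topological_monoid_mult \<Rightarrow> 'a \<Rightarrow> 'a"
  assumes continuous_action:
      "continuous_map (prod_topology euclidean X) X (\<lambda>(t, x). v t x)"
    and homeomorphic_action: "\<And>t. homeomorphic_map X X (v t)"
    and action_one: "\<And>x. x \<in> topspace X \<Longrightarrow> v 1 x = x"
    and action_mult: "\<And>g h x. x \<in> topspace X \<Longrightarrow> v g (v h x) = v (g * h) x"

definition orbit :: "('t \<Rightarrow> 'a \<Rightarrow> 'a) \<Rightarrow> 'a \<Rightarrow> 'a set" where
  "orbit v x = {v g x | g. True}"

definition equicontinuous_action :: "'a topology \<Rightarrow> ('t \<Rightarrow> 'a \<Rightarrow> 'a) \<Rightarrow> bool" where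
  "equicontinuous_action X v \<longleftrightarrow>
     (\<exists>d. Metric_space (topspace X) d \<and> Metric_space.mtopology (topspace X) d = X \<and>
        (\<forall>\<epsilon>>0. \<exists>\<delta>>0. \<forall>g. \<forall>x\<in>topspace X. \<forall>y\<in>topspace X.
            d x y < \<delta> \<longrightarrow> d (v g x) (v g y) < \<epsilon>))"

definition R_closed_action :: "'a topology \<Rightarrow> ('t \<Rightarrow> 'a \<Rightarrow> 'a) \<Rightarrow> bool" where
  "R_closed_action X v \<longleftrightarrow>
     closedin (prod_topology X X)
       {(x, y). x \<in> topspace X \<and> y \<in> topspace X \<and> y \<in> X closure_of (orbit v x)}"

definition directed_set :: "'i set \<Rightarrow> ('i \<Rightarrow> 'i \<Rightarrow> bool) \<Rightarrow> bool" where
  "directed_set I le \<longleftrightarrow> I \<noteq> {} \<and>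
     (\<forall>i\<in>I. le i i) \<and>
     (\<forall>i\<in>I. \<forall>j\<in>I. \<forall>k\<in>I. le i j \<longrightarrow> le j k \<longrightarrow> le i k) \<and>
     (\<forall>i\<in>I. \<forall>j\<in>I. \<exists>k\<in>I. le i k \<and> le j k)"

definition tail_filter :: "'i set \<Rightarrow> ('i \<Rightarrow> 'i \<Rightarrow> bool) \<Rightarrow> 'i filter" where
  "tail_filter I le = (INF i\<in>I. principal {j \<in> I. le i j})"

lemma eventually_tail_filter:
  assumes "directed_set I le"
  shows "eventually P (tail_filter I le) \<longleftrightarrow> (\<exists>i\<in>I. \<forall>j\<in>I. le i j \<longrightarrow> P j)"
  unfolding tail_filter_def
proof (subst eventually_INF_base)
  show "I \<noteq> {}" using assms by (simp add: directed_set_def)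
  fix a b assume ab: "a \<in> I" "b \<in> I"
  then obtain k where k: "k \<in> I" "le a k" "le b k"
    using assms unfolding directed_set_def by blast
  have "{j \<in> I. le k j} \<subseteq> {j \<in> I. le a j} \<inter> {j \<in> I. le b j}"
    using assms ab k unfolding directed_set_def by blast
  then show "\<exists>x\<in>I. principal {j \<in> I. le x j}
      \<le> inf (principal {j \<in> I. le a j}) (principal {j \<in> I. le b j})"
    using k(1) by auto
qed (auto simp: eventually_principal)

(* A definition cannot quantify over the type of the index set.  Index sets contained in
   'a set * 'a set suffice: mem_prolongation_if_nets shows that nets over directed sets of
   arbitrary types yield no further points. *)
definition prolongation :: "'a topology \<Rightarrow> ('t \<Rightarrow> 'a \<Rightarrow> 'a) \<Rightarrow> 'a \<Rightarrow> 'a set" where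
  "prolongation X v x =
     {y \<in> topspace X.
        \<exists>(I :: ('a set \<times> 'a set) set) le xs ys.
          directed_set I le \<and>
          (\<forall>i\<in>I. xs i \<in> topspace X \<and> ys i \<in> topspace X \<and> ys i \<in> orbit v (xs i)) \<and>
          limitin X ys y (tail_filter I le) \<and> limitin X xs x (tail_filter I le)}"

lemma mem_prolongation_if_nets:
  fixes I :: "'i set" and X :: "'a topology"
  assumes dir: "directed_set I le"
    and mem: "\<And>i. i \<in> I \<Longrightarrow> xs i \<in> topspace X \<and> ys i \<in> topspace X \<and> ys i \<in> orbit v (xs i)"
    and ys: "limitin X ys y (tail_filter I le)"
    and xs: "limitin X xs x (tail_filter I le)"
  shows "y \<in> prolongation X v x"
proof -
  define N where "N = {(U, V). openin X U \<and> x \<in> U \<and> openin X V \<and> y \<in> V}"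
  define ge :: "'a set \<times> 'a set \<Rightarrow> 'a set \<times> 'a set \<Rightarrow> bool"
    where "ge p q \<longleftrightarrow> fst q \<subseteq> fst p \<and> snd q \<subseteq> snd p" for p q
  have xy: "x \<in> topspace X" "y \<in> topspace X"
    using xs ys by (auto simp: limitin_def)
  have dirN: "directed_set N ge"
    unfolding directed_set_def
  proof (intro conjI ballI impI)
    show "N \<noteq> {}" using xy by (auto simp: N_def)
    fix p q assume "p \<in> N" "q \<in> N"
    then have "(fst p \<inter> fst q, snd p \<inter> snd q) \<in> N" by (auto simp: N_def)
    then show "\<exists>k\<in>N. ge p k \<and> ge q k" by (rule bexI[rotated]) (auto simp: ge_def)
  qed (auto simp: ge_def)
  have "\<exists>i\<in>I. xs i \<in> fst p \<and> ys i \<in> snd p" if "p \<in> N" for p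
  proof -
    have "eventually (\<lambda>i. xs i \<in> fst p) (tail_filter I le)"
         "eventually (\<lambda>i. ys i \<in> snd p) (tail_filter I le)"
      using that xs ys by (auto simp: N_def limitin_def)
    then have "eventually (\<lambda>i. xs i \<in> fst p \<and> ys i \<in> snd p) (tail_filter I le)"
      by (rule eventually_conj)
    then show ?thesis
      using dir unfolding eventually_tail_filter[OF dir] directed_set_def by blast
  qed
  then obtain c where c: "\<And>p. p \<in> N \<Longrightarrow> c p \<in> I \<and> xs (c p) \<in> fst p \<and> ys (c p) \<in> snd p"
    by metis
  have "limitin X (ys \<circ> c) y (tail_filter N ge)"
    unfolding limitin_def eventually_tail_filter[OF dirN]
  proof (intro conjI allI impI)
    fix V assume V: "openin X V \<and> y \<in> V"
    then have "(topspace X, V) \<in> N" using xy by (auto simp: N_def)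
    then show "\<exists>p\<in>N. \<forall>q\<in>N. ge p q \<longrightarrow> (ys \<circ> c) q \<in> V"
      by (rule bexI[rotated]) (use c in \<open>auto simp: ge_def\<close>)
  qed (rule xy)
  moreover have "limitin X (xs \<circ> c) x (tail_filter N ge)"
    unfolding limitin_def eventually_tail_filter[OF dirN]
  proof (intro conjI allI impI)
    fix U assume U: "openin X U \<and> x \<in> U"
    then have "(U, topspace X) \<in> N" using xy by (auto simp: N_def)
    then show "\<exists>p\<in>N. \<forall>q\<in>N. ge p q \<longrightarrow> (xs \<circ> c) q \<in> U"
      by (rule bexI[rotated]) (use c in \<open>auto simp: ge_def\<close>)
  qed (rule xy)
  moreover have "\<forall>p\<in>N. (xs \<circ> c) p \<in> topspace X \<and> (ys \<circ> c) p \<in> topspace X \<and>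
      (ys \<circ> c) p \<in> orbit v ((xs \<circ> c) p)"
    using c mem by auto
  ultimately show ?thesis
    unfolding prolongation_def using dirN xy by blast
qed

definition characteristic_0_action :: "'a topology \<Rightarrow> ('t \<Rightarrow> 'a \<Rightarrow> 'a) \<Rightarrow> bool" where
  "characteristic_0_action X v \<longleftrightarrow>
     (\<forall>x\<in>topspace X. X closure_of (orbit v x) = prolongation X v x)"

end

(* The prolongation relation is the closure in X \<times> X of the orbit relation.  Hence characteristic 0
   makes the orbit closure relation closed, and it remains to bound D(x) by the closure of T(x):
   if (x', g(x')) is close to (x, y), then by equicontinuity g(x) is close to g(x'), hence to y. *)
theory Submission
  imports Defs
begin

text \<open>Two nets on a common index set are one net in the product, and componentwise convergence
  is convergence there. Conversely, a point of the closure is the limit of a net chosen from its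
  neighbourhoods.\<close>

lemma mem_prolongation_iff_closure_of:
  "y \<in> prolongation X v x \<longleftrightarrow>
     (x, y) \<in> prod_topology X X closure_of
       {(x, y). x \<in> topspace X \<and> y \<in> topspace X \<and> y \<in> orbit v x}"
  (is "_ \<longleftrightarrow> _ \<in> ?P closure_of ?R")
proof
  assume "y \<in> prolongation X v x"
  then obtain I :: "('a set \<times> 'a set) set" and le xs ys where
      dir: "directed_set I le"
    and mem: "\<forall>i\<in>I. xs i \<in> topspace X \<and> ys i \<in> topspace X \<and> ys i \<in> orbit v (xs i)"
    and "limitin X ys y (tail_filter I le)" "limitin X xs x (tail_filter I le)"
    unfolding prolongation_def by blast
  then have lim: "limitin ?P (\<lambda>i. (xs i, ys i)) (x, y) (tail_filter I le)"
    by (simp add: limitin_pairwise o_def)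
  show "(x, y) \<in> ?P closure_of ?R"
    unfolding in_closure_of
  proof (intro conjI allI impI)
    show "(x, y) \<in> topspace ?P" using lim by (rule limitin_topspace)
    fix W assume "(x, y) \<in> W \<and> openin ?P W"
    \<comment> \<open>Some tail of the net lies in \<open>W\<close>; by reflexivity of
      \<open>le\<close> its starting index belongs to that tail.\<close>
    then obtain i where "i \<in> I" "(xs i, ys i) \<in> W"
      using lim dir unfolding limitin_def eventually_tail_filter[OF dir] directed_set_def by meson
    then show "\<exists>p. p \<in> ?R \<and> p \<in> W" using mem by blast
  qed
next
  assume xy: "(x, y) \<in> ?P closure_of ?R"
  \<comment> \<open>These indices are sets of pairs rather than pairs of sets, so the net built on
    them enters \<open>prolongation\<close> through \<open>mem_prolongation_if_nets\<close>.\<close>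
  define N where "N = {W. openin ?P W \<and> (x, y) \<in> W}"
  have top: "topspace ?P \<in> N"
    using xy openin_topspace[of ?P] unfolding N_def in_closure_of by blast
  have dir: "directed_set N (\<supseteq>)"
    unfolding directed_set_def
  proof (intro conjI ballI impI)
    show "N \<noteq> {}" using top by blast
    fix U V assume "U \<in> N" "V \<in> N"
    then have "U \<inter> V \<in> N" by (auto simp: N_def)
    then show "\<exists>W\<in>N. U \<supseteq> W \<and> V \<supseteq> W" by blast
  qed auto
  have "\<forall>W\<in>N. \<exists>p. p \<in> ?R \<and> p \<in> W"
    using xy unfolding in_closure_of N_def by blast
  from bchoice[OF this] obtain c where c: "\<forall>W\<in>N. c W \<in> ?R \<and> c W \<in> W" ..
  then have mem: "c W \<in> W" and rel: "fst (c W) \<in> topspace X \<and> snd (c W) \<in> topspace X \<and>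
      snd (c W) \<in> orbit v (fst (c W))" if "W \<in> N" for W
    using that by (simp_all add: case_prod_beta)
  have "limitin ?P c (x, y) (tail_filter N (\<supseteq>))"
    unfolding limitin_def eventually_tail_filter[OF dir]
  proof (intro conjI allI impI)
    show "(x, y) \<in> topspace ?P" using xy by (simp add: in_closure_of)
    fix W assume "openin ?P W \<and> (x, y) \<in> W"
    then have "W \<in> N" by (simp add: N_def)
    \<comment> \<open>The witness is \<open>W\<close> itself: \<open>c V\<close> lies in
      \<open>V\<close>, hence in \<open>W\<close>.\<close>
    then show "\<exists>U\<in>N. \<forall>V\<in>N. U \<supseteq> V \<longrightarrow> c V \<in> W" using mem by blast
  qed
  then have "limitin X (fst \<circ> c) x (tail_filter N (\<supseteq>))"
    and "limitin X (snd \<circ> c) y (tail_filter N (\<supseteq>))"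
    by (simp_all add: limitin_pairwise)
  then show "y \<in> prolongation X v x"
    using rel by (intro mem_prolongation_if_nets[OF dir, of "fst \<circ> c" X "snd \<circ> c"]) simp_all
qed

text \<open>The orbit relation contains the slice \<open>{x} \<times> orbit v x\<close>, and the
  closure of a product is the product of the closures. In terms of nets, \<open>xs\<close> is
  constantly \<open>x\<close>.\<close>

lemma closure_of_orbit_subset_prolongation:
  assumes "x \<in> topspace X" and "orbit v x \<subseteq> topspace X"
  shows "X closure_of (orbit v x) \<subseteq> prolongation X v x"
proof
  fix y assume "y \<in> X closure_of (orbit v x)"
  moreover have "x \<in> X closure_of {x}"
    using assms(1) closure_of_subset[of "{x}" X] by simp
  ultimately have "(x, y) \<in> prod_topology X X closure_of ({x} \<times> orbit v x)"
    by (simp add: closure_of_Times)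
  moreover have "{x} \<times> orbit v x
      \<subseteq> {(x, y). x \<in> topspace X \<and> y \<in> topspace X \<and> y \<in> orbit v x}"
    using assms by auto
  ultimately show "y \<in> prolongation X v x"
    unfolding mem_prolongation_iff_closure_of using closure_of_mono by blast
qed

lemma R_closed_action_if_characteristic_0:
  assumes "characteristic_0_action X v"
  shows "R_closed_action X v"
proof -
  have "{(x, y). x \<in> topspace X \<and> y \<in> topspace X \<and> y \<in> X closure_of (orbit v x)}
      = prod_topology X X closure_of
          {(x, y). x \<in> topspace X \<and> y \<in> topspace X \<and> y \<in> orbit v x}" (is "_ = ?C")
  proof -
    \<comment> \<open>Characteristic 0 speaks only of points of \<open>topspace X\<close>; this
      inclusion brings every pair of \<open>?C\<close> within its reach.\<close>
    have "?C \<subseteq> topspace X \<times> topspace X"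
      using closure_of_subset_topspace[of "prod_topology X X"] by simp
    then show ?thesis
      using assms unfolding characteristic_0_action_def
      by (auto simp: mem_prolongation_iff_closure_of)
  qed
  then show ?thesis
    unfolding R_closed_action_def by simp
qed

lemma prolongation_subset_closure_of_orbit:
  assumes "equicontinuous_action X v" and maps: "\<And>g. v g ` topspace X \<subseteq> topspace X"
  shows "prolongation X v x \<subseteq> X closure_of (orbit v x)"
proof
  fix y assume "y \<in> prolongation X v x"
  then have xy: "(x, y) \<in> prod_topology X X closure_of
      {(x, y). x \<in> topspace X \<and> y \<in> topspace X \<and> y \<in> orbit v x}"
    by (simp add: mem_prolongation_iff_closure_of)
  then have x: "x \<in> topspace X" and y: "y \<in> topspace X"
    by (auto simp: in_closure_of)
  from assms(1) obtain d where M: "Metric_space (topspace X) d"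
    and top: "Metric_space.mtopology (topspace X) d = X"
    and equi: "\<And>\<epsilon>. \<epsilon> > 0 \<Longrightarrow> \<exists>\<delta>>0. \<forall>g. \<forall>x\<in>topspace X. \<forall>y\<in>topspace X.
            d x y < \<delta> \<longrightarrow> d (v g x) (v g y) < \<epsilon>"
    unfolding equicontinuous_action_def by blast
  interpret Metric_space "topspace X" d by (rule M)
  have "\<exists>z \<in> orbit v x. z \<in> mball y r" if "r > 0" for r
  proof -
    \<comment> \<open>Since \<delta> is uniform in \<open>g\<close>, it can be fixed before the
      nearby pair \<open>(a, v g a)\<close>, and with it \<open>g\<close>, is found.\<close>
    obtain \<delta> where "\<delta> > 0" and \<delta>: "\<And>g a b. a \<in> topspace X \<Longrightarrow> b \<in> topspace X \<Longrightarrow>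
        d a b < \<delta> \<Longrightarrow> d (v g a) (v g b) < r / 2"
      using equi[OF half_gt_zero[OF \<open>r > 0\<close>]] by blast
    have "openin (prod_topology X X) (mball x \<delta> \<times> mball y (r / 2))"
      using openin_mball by (simp add: top openin_prod_Times_iff)
    moreover have "(x, y) \<in> mball x \<delta> \<times> mball y (r / 2)"
      using x y \<open>\<delta> > 0\<close> that by simp
    ultimately have "\<exists>p. p \<in> {(x, y). x \<in> topspace X \<and> y \<in> topspace X \<and> y \<in> orbit v x} \<and>
        p \<in> mball x \<delta> \<times> mball y (r / 2)"
      using xy by (simp only: in_closure_of)
    then obtain a b where "(a, b) \<in> mball x \<delta> \<times> mball y (r / 2)" "b \<in> orbit v a"
      by fast
    then obtain g where a: "a \<in> topspace X" "d x a < \<delta>"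
      and ga: "v g a \<in> topspace X" "d y (v g a) < r / 2"
      by (auto simp: orbit_def)
    \<comment> \<open>The triangle inequality for \<open>d\<close> holds only on the carrier, so
      \<open>v g x\<close> must be known to lie there.\<close>
    have gx: "v g x \<in> topspace X" using maps x by blast
    have "d y (v g x) \<le> d y (v g a) + d (v g a) (v g x)"
      using y ga gx by (simp add: triangle)
    also have "\<dots> < r / 2 + r / 2"
      using ga \<delta>[OF a(1) x] a by (intro add_strict_mono) (auto simp: commute)
    finally show ?thesis
      using y gx by (auto simp: orbit_def)
  qed
  then have "y \<in> mtopology closure_of (orbit v x)"
    using y by (auto simp: metric_closure_of)
  then show "y \<in> X closure_of (orbit v x)" by (simp add: top)
qed

theorem corollary3p3:
  fixes X :: "'a topology"
    and v :: "'t::topological_monoid_mult \<Rightarrow> 'a \<Rightarrow> 'a"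
  assumes "metrizable_space X"
    and "semigroup_action X v"
    and "equicontinuous_action X v"
  shows "R_closed_action X v \<and> characteristic_0_action X v"
proof -
  \<comment> \<open>A homeomorphism of \<open>X\<close> maps \<open>topspace X\<close> onto itself;
    both inclusions below rely on this.\<close>
  have maps: "v g ` topspace X \<subseteq> topspace X" for g
    using semigroup_action.homeomorphic_action[OF assms(2)]
      homeomorphic_imp_surjective_map by blast
  have "X closure_of (orbit v x) = prolongation X v x" if "x \<in> topspace X" for x
  proof
    have "orbit v x \<subseteq> topspace X"
      using maps that by (auto simp: orbit_def)
    then show "X closure_of (orbit v x) \<subseteq> prolongation X v x"
      by (rule closure_of_orbit_subset_prolongation[OF that])
  qed (rule prolongation_subset_closure_of_orbit[OF assms(3) maps])
  then have "characteristic_0_action X v"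
    by (simp add: characteristic_0_action_def)
  then show ?thesis
    by (simp add: R_closed_action_if_characteristic_0)
qed

end
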